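(* Let $R_3(n)$ be the number of partitions of $n$ with max-rook number $3$. For every integer $n>9$, $$R_3(n)\equiv\begin{cases} 0 \pmod 2, & \text{if } n \text{ is odd},\\ 1 \pmod 2, & \text{if } n \text{ is even}.\end{cases}$$
   Context: A partition $\pi$ of a positive integer $n$ is a non-increasing sequence of positive integers $(\lambda_1,\dots,\lambda_r)$ with sum $n$; $\mathscr{P}(n)$ is the set of all partitions of $n$. The Ferrers board $B_\pi$ of $\pi=(\lambda_1,\dots,\lambda_r)$ is the left-justified array of unit squares with $r$ rows whose $i$-th row from the top has $\lambda_i$ squares. Rooks placed on squares of the board are non-intersecting if no two of them lie in the same row or the same column. The max-rook number $R(\pi)$ is the maximal number of non-intersecting rooks that can be placed in $B_\pi$. For positive integers $n,k$, $R_k(n):=\#\{\pi\in\mathscr{P}(n) : R(\pi)=k\}$. *)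

theory Defs
  imports "HOL-Number_Theory.Cong"
begin

definition partitions :: "nat \<Rightarrow> nat list set" where
  "partitions n = {p. sorted_wrt (\<ge>) p \<and> (\<forall>x\<in>set p. 0 < x) \<and> sum_list p = n}"

text \<open>Squares are pairs (row, column), with rows counted from the top and columns
  from the left, both starting at 0.\<close>

definition ferrers_board :: "nat list \<Rightarrow> (nat \<times> nat) set" where
  "ferrers_board p = {(i, j). i < length p \<and> j < p ! i}"

definition non_intersecting :: "(nat \<times> nat) set \<Rightarrow> bool" where
  "non_intersecting S \<longleftrightarrow>
     (\<forall>s\<in>S. \<forall>t\<in>S. s \<noteq> t \<longrightarrow> fst s \<noteq> fst t \<and> snd s \<noteq> snd t)"

definition max_rook_number :: "nat list \<Rightarrow> nat" where
  "max_rook_number p = Max {card S |S. S \<subseteq> ferrers_board p \<and> non_intersecting S}"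

definition R :: "nat \<Rightarrow> nat \<Rightarrow> nat" where
  "R k n = card {p \<in> partitions n. max_rook_number p = k}"

text \<open>The sets under \<^const>\<open>card\<close> and \<^const>\<open>Max\<close> above are finite (and nonempty
  in the case of \<^const>\<open>Max\<close>), so neither takes a default value.\<close>

lemma finite_partitions: "finite (partitions n)"
proof (rule finite_subset)
  have "length p \<le> sum_list p" if "\<forall>x\<in>set p. 0 < x" for p :: "nat list"
    using that by (induction p) auto
  then show "partitions n \<subseteq> {p. set p \<subseteq> {..n} \<and> length p \<le> n}"
    by (auto simp: partitions_def member_le_sum_list)
  show "finite {p. set p \<subseteq> {..n} \<and> length p \<le> n}"
    by (rule finite_lists_length_le) simp
qed

lemma finite_ferrers_board: "finite (ferrers_board p)"
proof -
  have "ferrers_board p = (SIGMA i:{..<length p}. {..<p ! i})"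
    by (auto simp: ferrers_board_def)
  then show ?thesis by simp
qed

lemma finite_rook_counts:
  "finite {card S |S. S \<subseteq> ferrers_board p \<and> non_intersecting S}"
proof -
  have "{card S |S. S \<subseteq> ferrers_board p \<and> non_intersecting S} \<subseteq> card ` Pow (ferrers_board p)"
    by auto
  then show ?thesis
    by (rule finite_subset) (simp add: finite_ferrers_board)
qed

lemma rook_counts_nonempty:
  "{card S |S. S \<subseteq> ferrers_board p \<and> non_intersecting S} \<noteq> {}"
  by (auto simp: non_intersecting_def intro: exI[of _ "{}"])

end

theory Submission
  imports Defs
begin

text \<open>
  Partitions of \<open>n\<close> correspond to Young diagrams with \<open>n\<close> squares, that is, to finite subsets of
  \<open>\<nat> \<times> \<nat>\<close> closed towards the origin. By the lemma \<open>young_rooks_iff\<close>, \<open>k\<close> non-intersecting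
  rooks fit on a Young diagram exactly if it contains the antidiagonal \<open>{(i, j). i + j + 1 = k}\<close>:
  for \<open>i < k\<close>, among \<open>k\<close> such rooks at least \<open>k - i\<close> lie in row \<open>i\<close> or below, and as their columns are
  distinct one of them lies in column \<open>k - i - 1\<close> or further right.

  Transposition is an involution on the diagrams with \<open>n\<close> squares and max-rook number 3, so
  modulo 2 only the self-conjugate ones count. Such a diagram contains \<open>(0, 2)\<close>, \<open>(1, 1)\<close> and
  \<open>(2, 0)\<close>, but not all of \<open>(0, 3)\<close>, \<open>(1, 2)\<close>, \<open>(2, 1)\<close>, \<open>(3, 0)\<close>. By symmetry it either misses
  both \<open>(0, 3)\<close> and \<open>(3, 0)\<close>, and then has at most 9 squares, or it misses both \<open>(1, 2)\<close> and
  \<open>(2, 1)\<close>, and then it is the diagram of the partition \<open>(a, 2, 1, \<dots>, 1)\<close> of \<open>2 * a\<close> with \<open>a\<close>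
  parts. So for \<open>n > 9\<close> there is one self-conjugate diagram if \<open>n\<close> is even, and none otherwise.
\<close>

lemma even_card_iff_even_card_fixpoints:
  assumes "finite A" "\<And>x. x \<in> A \<Longrightarrow> f x \<in> A" "\<And>x. x \<in> A \<Longrightarrow> f (f x) = x"
  shows "even (card A) \<longleftrightarrow> even (card {x \<in> A. f x = x})"
  using assms
proof (induction A rule: finite_psubset_induct)
  case (psubset A)
  show ?case
  proof (cases "\<forall>x\<in>A. f x = x")
    case True
    then have "{x \<in> A. f x = x} = A" by auto
    then show ?thesis by simp
  next
    case False
    then obtain x where x: "x \<in> A" "f x \<noteq> x" by auto
    have fx: "f x \<in> A" "f (f x) = x" using x psubset.prems by auto
    let ?B = "A - {x, f x}"
    have "even (card ?B) \<longleftrightarrow> even (card {y \<in> ?B. f y = y})"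
    proof (rule psubset.IH)
      show "?B \<subset> A" using x by auto
      show "f y \<in> ?B" if "y \<in> ?B" for y
        using that psubset.prems fx by (metis DiffE DiffI insertCI insertE singletonD)
      show "f (f y) = y" if "y \<in> ?B" for y using that psubset.prems by auto
    qed
    moreover have "{y \<in> ?B. f y = y} = {y \<in> A. f y = y}" using x fx by auto
    moreover have "card A = card ?B + 2"
    proof -
      have "card ?B = card A - card {x, f x}"
        by (rule card_Diff_subset) (use x fx in auto)
      moreover have "card {x, f x} \<le> card A"
        by (rule card_mono) (use psubset x fx in auto)
      moreover have "card {x, f x} = 2" using x by auto
      ultimately show ?thesis by simp
    qed
    ultimately show ?thesis by simp
  qed
qed

lemma down_closed_nat_eq_lessThan_card:
  fixes A :: "nat set"
  assumes "finite A" "\<And>x y. x \<in> A \<Longrightarrow> y \<le> x \<Longrightarrow> y \<in> A"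
  shows "A = {..<card A}"
proof (cases "A = {}")
  case False
  then have "A = {..Max A}" using assms by (auto intro: assms(2)[OF Max_in])
  then have "A = {..<Suc (Max A)}" by (simp add: lessThan_Suc_atMost)
  then show ?thesis by (metis card_lessThan)
qed auto


section \<open>Young diagrams and partitions\<close>

text \<open>A Young diagram is a finite set of squares that contains, with each square, all squares
  weakly above it and weakly to its left.\<close>

definition young :: "(nat \<times> nat) set \<Rightarrow> bool" where
  "young B \<longleftrightarrow> finite B \<and>
     (\<forall>i j i' j'. (i, j) \<in> B \<longrightarrow> i' \<le> i \<longrightarrow> j' \<le> j \<longrightarrow> (i', j') \<in> B)"

lemma youngD: "young B \<Longrightarrow> (i, j) \<in> B \<Longrightarrow> i' \<le> i \<Longrightarrow> j' \<le> j \<Longrightarrow> (i', j') \<in> B"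
  by (auto simp: young_def)

lemma young_finite: "young B \<Longrightarrow> finite B"
  by (simp add: young_def)

lemma young_row:
  assumes "young B"
  shows "(i, j) \<in> B \<longleftrightarrow> j < card {j. (i, j) \<in> B}"
proof -
  have "finite {j. (i, j) \<in> B}"
    by (rule finite_subset[of _ "snd ` B"]) (use assms in \<open>force simp: young_def\<close>)+
  then have "{j. (i, j) \<in> B} = {..<card {j. (i, j) \<in> B}}"
    by (rule down_closed_nat_eq_lessThan_card) (use youngD[OF assms] in auto)
  then show ?thesis by auto
qed

lemma young_swap: "young B \<Longrightarrow> young (prod.swap ` B)"
  unfolding young_def by auto

lemma young_column:
  assumes "young B"
  shows "(i, j) \<in> B \<longleftrightarrow> i < card {i. (i, j) \<in> B}"
  using young_row[OF young_swap[OF assms], of j i]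
  by simp

lemma ferrers_board_Sigma: "ferrers_board p = (SIGMA i:{..<length p}. {..<p ! i})"
  by (auto simp: ferrers_board_def)

lemma card_ferrers_board: "card (ferrers_board p) = sum_list p"
  by (simp add: ferrers_board_Sigma sum_list_sum_nth atLeast0LessThan)

lemma young_ferrers_board:
  assumes "p \<in> partitions n"
  shows "young (ferrers_board p)"
proof -
  have "p ! i \<le> p ! i'" if "i' \<le> i" "i < length p" for i i'
    using that assms by (cases "i' = i") (auto simp: partitions_def sorted_wrt_iff_nth_less)
  then show ?thesis
    by (auto simp: young_def finite_ferrers_board) (force simp: ferrers_board_def)
qed

lemma inj_on_ferrers_board: "inj_on ferrers_board (partitions n)"
proof (rule inj_onI)
  fix p q assume p: "p \<in> partitions n" and q: "q \<in> partitions n"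
    and eq: "ferrers_board p = ferrers_board q"
  (* As all parts are positive, column 0 of the board records the number of parts. *)
  have col: "{i. (i, 0) \<in> ferrers_board r} = {..<length r}" if "r \<in> partitions n" for r
    using that by (auto simp: ferrers_board_def partitions_def)
  then have len: "length p = length q"
    using p q eq by (metis card_lessThan)
  have "{j. (i, j) \<in> ferrers_board r} = {..<r ! i}" if "i < length r" for i r
    using that by (auto simp: ferrers_board_def)
  then have "p ! i = q ! i" if "i < length p" for i
    using that len eq by (metis card_lessThan)
  with len show "p = q" by (simp add: nth_equalityI)
qed

lemma young_imp_ferrers_board:
  assumes B: "young B"
  shows "B \<in> ferrers_board ` partitions (card B)"
proof -
  define p where
    "p = map (\<lambda>i. card {j. (i, j) \<in> B}) [0..<card {i. (i, 0) \<in> B}]"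
  have len: "i < length p \<longleftrightarrow> (i, 0) \<in> B" for i
    using young_column[OF B, of i 0] by (simp add: p_def)
  have nth: "p ! i = card {j. (i, j) \<in> B}" if "i < length p" for i
    using that by (simp add: p_def)
  have "(i, j) \<in> ferrers_board p \<longleftrightarrow> (i, j) \<in> B" for i j
    using len[of i] nth[of i] young_row[OF B, of i j] youngD[OF B, of i j i 0]
    by (auto simp: ferrers_board_def)
  then have board: "ferrers_board p = B" by auto
  have "0 < p ! i" if "i < length p" for i
    using that young_row[OF B, of i 0] by (simp add: len nth)
  then have pos: "\<forall>x\<in>set p. 0 < x" by (auto simp: in_set_conv_nth)
  have "p ! i' \<le> p ! i" if "i < i'" "i' < length p" for i i'
  proof -
    have "j < p ! i" if "j < p ! i'" for j
      using that \<open>i < i'\<close> \<open>i' < length p\<close> nth[of i] nth[of i']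
        young_row[OF B, of i j] young_row[OF B, of i' j] youngD[OF B, of i' j i j] by auto
    then show ?thesis by (meson linorder_not_le less_irrefl)
  qed
  then have "sorted_wrt (\<ge>) p" by (simp add: sorted_wrt_iff_nth_less)
  with pos board have "p \<in> partitions (card B)"
    using card_ferrers_board[of p] by (simp add: partitions_def)
  with board show ?thesis by blast
qed

lemma bij_betw_ferrers_board:
  "bij_betw ferrers_board (partitions n) {B. young B \<and> card B = n}"
  unfolding bij_betw_def
  using inj_on_ferrers_board young_ferrers_board young_imp_ferrers_board
  by (auto simp: card_ferrers_board partitions_def)


section \<open>Rook placements on Young diagrams\<close>

lemma young_rooks_iff:
  assumes B: "young B"
  shows "(\<exists>S. S \<subseteq> B \<and> non_intersecting S \<and> card S = k) \<longleftrightarrow> (\<forall>i<k. (i, k - 1 - i) \<in> B)"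
proof
  assume "\<exists>S. S \<subseteq> B \<and> non_intersecting S \<and> card S = k"
  then obtain S where S: "S \<subseteq> B" "non_intersecting S" "card S = k" by auto
  have fin: "finite S" using S B young_finite finite_subset by blast
  have inj: "inj_on fst S" "inj_on snd S"
    using S(2) by (auto simp: non_intersecting_def inj_on_def)
  show "\<forall>i<k. (i, k - 1 - i) \<in> B"
  proof (intro allI impI)
    fix i assume "i < k"
    let ?above = "{s \<in> S. fst s < i}" and ?below = "{s \<in> S. i \<le> fst s}"
    have "card ?above \<le> card {..<i}"
      by (rule card_inj_on_le[of fst]) (use inj in \<open>auto intro: inj_on_subset\<close>)
    moreover have "card S = card ?above + card ?below"
      by (subst card_Un_disjoint[symmetric]) (use fin in \<open>auto intro: arg_cong[where f = card]\<close>)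
    ultimately have below: "k - i \<le> card ?below" using S(3) by simp
    have "\<exists>s\<in>?below. k - 1 - i \<le> snd s"
    proof (rule ccontr)
      assume "\<not> ?thesis"
      then have "snd ` ?below \<subseteq> {..<k - 1 - i}" by (force simp flip: not_le)
      then have "card ?below \<le> card {..<k - 1 - i}"
        by (intro card_inj_on_le[of snd]) (use inj in \<open>auto intro: inj_on_subset\<close>)
      with below \<open>i < k\<close> show False by simp
    qed
    then obtain r c where "(r, c) \<in> B" "i \<le> r" "k - 1 - i \<le> c" using S(1) by auto
    then show "(i, k - 1 - i) \<in> B" using youngD[OF B] by blast
  qed
next
  assume diag: "\<forall>i<k. (i, k - 1 - i) \<in> B"
  let ?S = "(\<lambda>i. (i, k - 1 - i)) ` {..<k}"
  have "?S \<subseteq> B" using diag by auto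
  moreover have "non_intersecting ?S" by (auto simp: non_intersecting_def)
  moreover have "card ?S = k" by (subst card_image) (auto simp: inj_on_def)
  ultimately show "\<exists>S. S \<subseteq> B \<and> non_intersecting S \<and> card S = k" by blast
qed

lemma le_max_rook_number_iff:
  assumes "p \<in> partitions n"
  shows "k \<le> max_rook_number p \<longleftrightarrow> (\<forall>i<k. (i, k - 1 - i) \<in> ferrers_board p)"
proof -
  let ?B = "ferrers_board p"
  let ?C = "{card S |S. S \<subseteq> ?B \<and> non_intersecting S}"
  have "k \<le> max_rook_number p \<longleftrightarrow> (\<exists>m\<in>?C. k \<le> m)"
    unfolding max_rook_number_def
    by (rule Max_ge_iff[OF finite_rook_counts rook_counts_nonempty])
  also have "\<dots> \<longleftrightarrow> (\<exists>S. S \<subseteq> ?B \<and> non_intersecting S \<and> card S = k)"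
  proof
    assume "\<exists>m\<in>?C. k \<le> m"
    then obtain S where S: "S \<subseteq> ?B" "non_intersecting S" "k \<le> card S" by auto
    from obtain_subset_with_card_n[OF S(3)] obtain T where "T \<subseteq> S" "card T = k" by auto
    with S show "\<exists>S. S \<subseteq> ?B \<and> non_intersecting S \<and> card S = k"
      unfolding non_intersecting_def by (intro exI[of _ T]) blast
  qed auto
  also have "\<dots> \<longleftrightarrow> (\<forall>i<k. (i, k - 1 - i) \<in> ?B)"
    by (rule young_rooks_iff[OF young_ferrers_board[OF assms]])
  finally show ?thesis .
qed

text \<open>The Young diagrams with max-rook number 3, in the form that the criterion above gives.\<close>

definition young_rook3 :: "(nat \<times> nat) set \<Rightarrow> bool" where
  "young_rook3 B \<longleftrightarrow> young B \<and> (0, 2) \<in> B \<and> (1, 1) \<in> B \<and> (2, 0) \<in> B \<and>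
     \<not> ((0, 3) \<in> B \<and> (1, 2) \<in> B \<and> (2, 1) \<in> B \<and> (3, 0) \<in> B)"

lemma max_rook_number_eq_3_iff:
  assumes "p \<in> partitions n"
  shows "max_rook_number p = 3 \<longleftrightarrow> young_rook3 (ferrers_board p)"
proof -
  have "max_rook_number p = 3 \<longleftrightarrow> 3 \<le> max_rook_number p \<and> \<not> 4 \<le> max_rook_number p" by auto
  then show ?thesis
    using young_ferrers_board[OF assms]
    by (auto simp: le_max_rook_number_iff[OF assms] young_rook3_def numeral_eq_Suc All_less_Suc2)
qed

lemma bij_betw_R3:
  "bij_betw ferrers_board {p \<in> partitions n. max_rook_number p = 3}
    {B. young_rook3 B \<and> card B = n}"
proof (rule bij_betw_subset[OF bij_betw_ferrers_board[of n]])
  have "ferrers_board ` {p \<in> partitions n. max_rook_number p = 3}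
    = {B \<in> ferrers_board ` partitions n. young_rook3 B}"
    using max_rook_number_eq_3_iff by blast
  also have "ferrers_board ` partitions n = {B. young B \<and> card B = n}"
    using bij_betw_ferrers_board[of n] by (simp add: bij_betw_def)
  also have "{B \<in> \<dots>. young_rook3 B} = {B. young_rook3 B \<and> card B = n}"
    by (auto simp: young_rook3_def)
  finally show "ferrers_board ` {p \<in> partitions n. max_rook_number p = 3}
    = {B. young_rook3 B \<and> card B = n}" .
qed auto


section \<open>Self-conjugate diagrams\<close>

text \<open>The Young diagram of the self-conjugate partition \<open>(a, 2, 1, \<dots>, 1)\<close> with \<open>a\<close> parts,
  for \<open>a \<ge> 2\<close>.\<close>

definition boxed_hook :: "nat \<Rightarrow> (nat \<times> nat) set" where
  "boxed_hook a = insert (1, 1) ({0} \<times> {..<a} \<union> {1..<a} \<times> {0})"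

lemma card_boxed_hook:
  assumes "a > 0"
  shows "card (boxed_hook a) = 2 * a"
proof -
  have "card ({0::nat} \<times> {..<a} \<union> {1..<a} \<times> {0::nat}) = a + (a - 1)"
    by (subst card_Un_disjoint) (auto simp: card_cartesian_product)
  then show ?thesis
    unfolding boxed_hook_def using assms by (subst card_insert_disjoint) auto
qed

lemma young_rook3_boxed_hook:
  assumes "a \<ge> 3"
  shows "young_rook3 (boxed_hook a)"
  unfolding young_rook3_def young_def boxed_hook_def using assms by auto

lemma swap_boxed_hook: "prod.swap ` boxed_hook a = boxed_hook a"
  unfolding boxed_hook_def image_insert image_Un product_swap by auto

lemma self_conjugate_young_rook3:
  assumes B: "young_rook3 B" and sym: "prod.swap ` B = B" and card: "card B > 9"
  shows "\<exists>a\<ge>3. B = boxed_hook a"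
proof -
  have y: "young B" using B by (simp add: young_rook3_def)
  have swap: "(i, j) \<in> B \<longleftrightarrow> (j, i) \<in> B" for i j
    using sym by (metis pair_in_swap_image)
  have "(0, 3) \<in> B"
  proof (rule ccontr)
    assume no: "(0, 3) \<notin> B"
    have "i < 3 \<and> j < 3" if "(i, j) \<in> B" for i j
      using that no swap youngD[OF y, of i j 0 3] youngD[OF y, of i j 3 0] by (metis not_le le0)
    then have "B \<subseteq> {..<3} \<times> {..<3}" by auto
    then have "card B \<le> card ({..<3::nat} \<times> {..<3::nat})" by (intro card_mono) auto
    with card show False by (simp add: card_cartesian_product)
  qed
  then have no: "(1, 2) \<notin> B" "(2, 1) \<notin> B" and yes: "(1, 1) \<in> B"
    using B swap by (auto simp: young_rook3_def)
  have inner: "i = 1 \<and> j = 1" if "(i, j) \<in> B" "i \<ge> 1" "j \<ge> 1" for i j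
    using that no youngD[OF y, of i j 1 2] youngD[OF y, of i j 2 1] by force
  define a where "a = card {j. (0, j) \<in> B}"
  have row: "(0, j) \<in> B \<longleftrightarrow> j < a" for j
    unfolding a_def by (rule young_row[OF y])
  have "a \<ge> 3" using row[of 3] \<open>(0, 3) \<in> B\<close> by simp
  moreover have "(i, j) \<in> B \<longleftrightarrow> (i, j) \<in> boxed_hook a" for i j
    using row swap[of i 0] yes inner[of i j] by (cases i; cases j) (auto simp: boxed_hook_def)
  ultimately show ?thesis by auto
qed

lemma self_conjugate_young_rook3_eq:
  assumes "n > 9"
  shows "{B. young_rook3 B \<and> card B = n \<and> prod.swap ` B = B}
    = (if even n then {boxed_hook (n div 2)} else {})"
proof -
  have "young_rook3 B \<and> card B = n \<and> prod.swap ` B = B \<longleftrightarrow> even n \<and> B = boxed_hook (n div 2)" for B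
  proof
    assume *: "young_rook3 B \<and> card B = n \<and> prod.swap ` B = B"
    with assms self_conjugate_young_rook3 obtain a where "a \<ge> 3" "B = boxed_hook a" by blast
    with * card_boxed_hook[of a] have "n = 2 * a" by simp
    with \<open>B = boxed_hook a\<close> show "even n \<and> B = boxed_hook (n div 2)" by simp
  next
    assume "even n \<and> B = boxed_hook (n div 2)"
    with assms show "young_rook3 B \<and> card B = n \<and> prod.swap ` B = B"
      using young_rook3_boxed_hook[of "n div 2"] card_boxed_hook[of "n div 2"]
      by (auto simp: swap_boxed_hook)
  qed
  then show ?thesis by (cases "even n") simp_all
qed

lemma young_rook3_swap: "young_rook3 B \<Longrightarrow> young_rook3 (prod.swap ` B)"
  using young_swap by (auto simp: young_rook3_def)


section \<open>The parity of the number of partitions with max-rook number 3\<close>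

theorem theorem4p5:
  fixes n :: nat
  assumes "n > 9"
  shows "(odd n \<longrightarrow> [R 3 n = 0] (mod 2)) \<and> (even n \<longrightarrow> [R 3 n = 1] (mod 2))"
proof -
  let ?A = "{B. young_rook3 B \<and> card B = n}"
  have R: "R 3 n = card ?A"
    unfolding R_def by (rule bij_betw_same_card[OF bij_betw_R3])
  have "finite {p \<in> partitions n. max_rook_number p = 3}"
    using finite_partitions by simp
  then have "finite ?A" using bij_betw_finite[OF bij_betw_R3] by blast
  then have "even (card ?A) \<longleftrightarrow> even (card {B \<in> ?A. prod.swap ` B = B})"
    by (rule even_card_iff_even_card_fixpoints)
       (auto simp: young_rook3_swap card_image image_comp)
  also have "{B \<in> ?A. prod.swap ` B = B} = {B. young_rook3 B \<and> card B = n \<and> prod.swap ` B = B}"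
    by auto
  finally have "even (R 3 n) \<longleftrightarrow> odd n"
    using self_conjugate_young_rook3_eq[OF assms] by (simp add: R split: if_splits)
  then show ?thesis by (auto simp: cong_def even_iff_mod_2_eq_zero odd_iff_mod_2_eq_one)
qed

end
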